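(* Let $C$ be an $n$-qubit Clifford+$T$ circuit and let $\pi$ be a bipartition of its qubits into sides $A$ and $B$ under which $C$ has $d$ cross-cut gates, each of which admits a rank-2 decomposition. Let $G_A,G_B$ be the leaf gate counts on the two sides, and let $\mathrm{cost}_{\mathrm{leaf}}(A)$ and $\mathrm{cost}_{\mathrm{leaf}}(B)$ be the per-leaf costs realised on sides $A$ and $B$ by the backend selector, each within the leaf's error budget $\epsilon_{\mathrm{leaf}}$. Then the single-level amplitude algorithm computes any single amplitude $\langle x|C|0^n\rangle$, $x\in\{0,1\}^n$, to accuracy $\epsilon_{\mathrm{leaf}}$ per leaf, in time $$O\!\left(2^d\cdot\left[\mathrm{cost}_{\mathrm{leaf}}(A)+\mathrm{cost}_{\mathrm{leaf}}(B)\right]\right).$$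
   Context: Cross-cut gates: a two-qubit gate of $C$ is cross-cut under $\pi=(A,B)$ if it acts on one qubit in $A$ and one in $B$; it has a rank-2 decomposition if it equals $\sum_{\alpha\in\{0,1\}}U_A^{(\alpha)}\otimes U_B^{(\alpha)}$ (e.g. $\mathrm{CZ}_{ab}=|0\rangle\langle0|_a\otimes I_b+|1\rangle\langle1|_a\otimes Z_b$). $T$ gates are single-qubit and hence never cross-cut. Single-level algorithm: split $x=(x_A,x_B)$. For every path $\alpha\in\{0,1\}^d$, form a circuit on $A$ and a circuit on $B$ by keeping the gates local to that side and replacing each cross-cut gate $g$ by its term selected by $\alpha_g$ on that side; call the leaf oracle LeafAmplitude once on the $A$-circuit with target $x_A$ (giving $a_A$) and once on the $B$-circuit with target $x_B$ (giving $a_B$); add $\mathrm{ph}_\alpha\, a_A a_B$ to a running total, where $\mathrm{ph}_\alpha$ is a scalar collecting the sign and normalization factors of the projections along the path. Return the total. Leaf oracle and selector: LeafAmplitude computes $\langle y|U|0^m\rangle$ for an $m$-qubit circuit $U$ with $G$ gates and $T$ $T$-gates using one of four backends $B$ with cost $C_B$ and error $E_B$: frame (stabilizer frame with $F\le 2^T$ elements), cost $O(G F m^2)$, error $0$; dense (state vector), cost $O(G\,2^m)$, error $0$; mps (Clifford tableau plus matrix product state of bond dimension $\chi$), cost $O(G m\chi^2)$, error the discarded SVD norm; rank (Bravyi--Gosset stabilizer-rank decomposition with Hamming-weight cap $h$), cost $O\big(G\sum_{k\le h}\binom{T}{k}m^2\big)$, error a binomial tail. The selector chooses $\operatorname{arg\,min}_B\{C_B: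 E_B\le\epsilon_{\mathrm{leaf}}\}$, where $\epsilon_{\mathrm{leaf}}\ge0$ is the per-leaf tolerance on the absolute error of the leaf amplitude; $\mathrm{cost}_{\mathrm{leaf}}$ of a side is the cost of the chosen backend on that side's circuit. *)

theory Defs
  imports "HOL-Analysis.Analysis"
begin

text \<open>Matrices are indexed by bit values, with \<^term>\<open>False\<close> for 0 and \<^term>\<open>True\<close> for 1.\<close>

type_synonym op1 = "complex ^ bool ^ bool"
type_synonym op2 = "complex ^ (bool \<times> bool) ^ (bool \<times> bool)"

definition scale :: "complex \<Rightarrow> complex ^ 'n ^ 'm \<Rightarrow> complex ^ 'n ^ 'm"
  where "scale c M = (\<chi> i j. c * M $ i $ j)"

definition kron :: "op1 \<Rightarrow> op1 \<Rightarrow> op2"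
  where "kron M N = (\<chi> i j. M $ fst i $ fst j * N $ snd i $ snd j)"

definition dagger :: "complex ^ 'n ^ 'm \<Rightarrow> complex ^ 'm ^ 'n"
  where "dagger M = (\<chi> i j. cnj (M $ j $ i))"

definition pauli_X :: op1 where "pauli_X = (\<chi> i j. if i = j then 0 else 1)"
definition pauli_Y :: op1 where "pauli_Y = (\<chi> i j. if i = j then 0 else if i then \<i> else - \<i>)"
definition pauli_Z :: op1 where "pauli_Z = (\<chi> i j. if i \<noteq> j then 0 else if i then - 1 else 1)"

definition paulis :: "op1 set"
  where "paulis = {mat 1, pauli_X, pauli_Y, pauli_Z}"

definition pauli_group1 :: "op1 set"
  where "pauli_group1 = {scale c P | c P. c \<in> {1, - 1, \<i>, - \<i>} \<and> P \<in> paulis}"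

definition pauli_group2 :: "op2 set"
  where "pauli_group2 =
    {scale c (kron P Q) | c P Q. c \<in> {1, - 1, \<i>, - \<i>} \<and> P \<in> paulis \<and> Q \<in> paulis}"

definition clifford :: "(complex ^ 'n ^ 'n) set \<Rightarrow> complex ^ 'n ^ 'n \<Rightarrow> bool"
  where "clifford \<P> U \<longleftrightarrow>
    dagger U ** U = mat 1 \<and> (\<lambda>P. U ** P ** dagger U) ` \<P> = \<P>"

definition T_matrix :: op1
  where "T_matrix = (\<chi> i j. if i \<noteq> j then 0 else if i then cis (pi / 4) else 1)"

text \<open>
  Qubits are labelled by natural numbers, so that a circuit on a side of a bipartition can keep the
  labels of the full circuit; a bit string on a set of qubits is an extensional function on it, and
  a state assigns amplitudes to bit strings. The operator of \<^term>\<open>Op1\<close> need not be unitary: leaf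
  circuits contain the terms of rank-2 decompositions, such as projections. A circuit is a list of
  gates, the head being applied first.
\<close>

datatype gate = T_gate nat | Op1 op1 nat | Op2 op2 nat nat

type_synonym circuit = "gate list"

fun qubits :: "gate \<Rightarrow> nat set" where
  "qubits (T_gate q) = {q}"
| "qubits (Op1 U q) = {q}"
| "qubits (Op2 U q r) = {q, r}"

fun clifford_T_gate :: "gate \<Rightarrow> bool" where
  "clifford_T_gate (T_gate q) = True"
| "clifford_T_gate (Op1 U q) = clifford pauli_group1 U"
| "clifford_T_gate (Op2 U q r) = (q \<noteq> r \<and> clifford pauli_group2 U)"

definition clifford_T_circuit :: "nat \<Rightarrow> circuit \<Rightarrow> bool"
  where "clifford_T_circuit n C \<longleftrightarrow> (\<forall>g\<in>set C. clifford_T_gate g \<and> qubits g \<subseteq> {..<n})"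

definition T_count :: "circuit \<Rightarrow> nat"
  where "T_count c = length (filter (\<lambda>g. \<exists>q. g = T_gate q) c)"

type_synonym bits = "nat \<Rightarrow> bool"

definition bitstrings :: "nat set \<Rightarrow> bits set"
  where "bitstrings Q = (Q \<rightarrow>\<^sub>E UNIV)"

definition apply1 :: "op1 \<Rightarrow> nat \<Rightarrow> (bits \<Rightarrow> complex) \<Rightarrow> bits \<Rightarrow> complex"
  where "apply1 U q \<psi> = (\<lambda>y. \<Sum>b\<in>UNIV. U $ y q $ b * \<psi> (y(q := b)))"

definition apply2 :: "op2 \<Rightarrow> nat \<Rightarrow> nat \<Rightarrow> (bits \<Rightarrow> complex) \<Rightarrow> bits \<Rightarrow> complex"
  where "apply2 U q r \<psi> =
    (\<lambda>y. \<Sum>(b, c)\<in>UNIV. U $ (y q, y r) $ (b, c) * \<psi> (y(q := b, r := c)))"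

fun apply_gate :: "gate \<Rightarrow> (bits \<Rightarrow> complex) \<Rightarrow> bits \<Rightarrow> complex" where
  "apply_gate (T_gate q) = apply1 T_matrix q"
| "apply_gate (Op1 U q) = apply1 U q"
| "apply_gate (Op2 U q r) = apply2 U q r"

definition ket :: "bits \<Rightarrow> bits \<Rightarrow> complex"
  where "ket z = (\<lambda>y. if y = z then 1 else 0)"

definition amplitude :: "nat set \<Rightarrow> circuit \<Rightarrow> bits \<Rightarrow> complex"
  where "amplitude Q c y = fold apply_gate c (ket (\<lambda>q\<in>Q. False)) y"

fun cross_cut :: "nat set \<Rightarrow> nat set \<Rightarrow> gate \<Rightarrow> bool" where
  "cross_cut A B (Op2 U q r) = (q \<in> A \<and> r \<in> B \<or> q \<in> B \<and> r \<in> A)"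
| "cross_cut A B _ = False"

definition cross_cut_count :: "nat set \<Rightarrow> nat set \<Rightarrow> circuit \<Rightarrow> nat"
  where "cross_cut_count A B C = length (filter (cross_cut A B) C)"

text \<open>The tensor factors of a matrix follow the order of the qubits of the gate, not of the sides:\<close>

fun rank2_decomposition ::
    "nat set \<Rightarrow> nat set \<Rightarrow> gate \<Rightarrow> (bool \<Rightarrow> op1) \<Rightarrow> (bool \<Rightarrow> op1) \<Rightarrow> bool" where
  "rank2_decomposition A B (Op2 U q r) U\<^sub>A U\<^sub>B \<longleftrightarrow>
     q \<in> A \<and> r \<in> B \<and> U = (\<Sum>\<alpha>\<in>UNIV. kron (U\<^sub>A \<alpha>) (U\<^sub>B \<alpha>)) \<or>
     q \<in> B \<and> r \<in> A \<and> U = (\<Sum>\<alpha>\<in>UNIV. kron (U\<^sub>B \<alpha>) (U\<^sub>A \<alpha>))"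
| "rank2_decomposition A B _ U\<^sub>A U\<^sub>B \<longleftrightarrow> False"

text \<open>
  The algorithm may place the two factors of a term in the leaf circuits up to sign and
  normalization (for instance as bare projections); \<open>coef\<close> is the scalar thereby left out.
\<close>

record splitting =
  coef :: "bool \<Rightarrow> complex"
  opA :: "bool \<Rightarrow> op1"
  opB :: "bool \<Rightarrow> op1"

definition splits :: "nat set \<Rightarrow> nat set \<Rightarrow> gate \<Rightarrow> splitting \<Rightarrow> bool"
  where "splits A B g s \<longleftrightarrow>
    rank2_decomposition A B g (\<lambda>\<alpha>. scale (coef s \<alpha>) (opA s \<alpha>)) (opB s)"

definition paths :: "nat \<Rightarrow> bool list set"
  where "paths d = {\<alpha>. length \<alpha> = d}"

text \<open>
  The leaf circuit on side \<open>S\<close> for a path, whose bits are consumed by the cross-cut gates in order;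
  \<open>u g b\<close> is the term of the cross-cut gate \<open>g\<close> on side \<open>S\<close> that bit \<open>b\<close> selects.
\<close>

fun leaf_circuit :: "nat set \<Rightarrow> (gate \<Rightarrow> bool \<Rightarrow> op1) \<Rightarrow> circuit \<Rightarrow> bool list \<Rightarrow> circuit" where
  "leaf_circuit S u [] \<alpha> = []"
| "leaf_circuit S u (g # C) \<alpha> =
     (if qubits g \<subseteq> S then g # leaf_circuit S u C \<alpha>
      else if qubits g \<inter> S = {} then leaf_circuit S u C \<alpha>
      else Op1 (u g (hd \<alpha>)) (the_elem (qubits g \<inter> S)) # leaf_circuit S u C (tl \<alpha>))"

abbreviation leaf_A :: "nat set \<Rightarrow> (gate \<Rightarrow> splitting) \<Rightarrow> circuit \<Rightarrow> bool list \<Rightarrow> circuit"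
  where "leaf_A A dec \<equiv> leaf_circuit A (\<lambda>g. opA (dec g))"

abbreviation leaf_B :: "nat set \<Rightarrow> (gate \<Rightarrow> splitting) \<Rightarrow> circuit \<Rightarrow> bool list \<Rightarrow> circuit"
  where "leaf_B B dec \<equiv> leaf_circuit B (\<lambda>g. opB (dec g))"

fun path_phase ::
    "nat set \<Rightarrow> nat set \<Rightarrow> (gate \<Rightarrow> splitting) \<Rightarrow> circuit \<Rightarrow> bool list \<Rightarrow> complex" where
  "path_phase A B dec [] \<alpha> = 1"
| "path_phase A B dec (g # C) \<alpha> =
     (if cross_cut A B g then coef (dec g) (hd \<alpha>) * path_phase A B dec C (tl \<alpha>)
      else path_phase A B dec C \<alpha>)"

text \<open>
  The four backends are oracles. What is left open about them is a parameter: the number of frame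
  elements, the bond dimension, the Hamming-weight cap and the discarded singular-value norm for a
  leaf circuit, the two weights of the binomial tail, and for each leaf call the returned value and
  the number of steps spent.
\<close>

datatype backend = Frame | Dense | MPS | Rank

record leaf_oracle =
  frame_size :: "nat set \<Rightarrow> circuit \<Rightarrow> nat"
  bond_dim :: "nat set \<Rightarrow> circuit \<Rightarrow> nat"
  weight_cap :: "nat set \<Rightarrow> circuit \<Rightarrow> nat"
  svd_discarded :: "nat set \<Rightarrow> circuit \<Rightarrow> real"
  tail_p :: real
  tail_q :: real
  answer :: "backend \<Rightarrow> nat set \<Rightarrow> circuit \<Rightarrow> bits \<Rightarrow> complex"
  run_time :: "backend \<Rightarrow> nat set \<Rightarrow> circuit \<Rightarrow> bits \<Rightarrow> nat"

fun backend_cost :: "leaf_oracle \<Rightarrow> nat set \<Rightarrow> circuit \<Rightarrow> backend \<Rightarrow> nat" where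
  "backend_cost M Q c Frame = length c * frame_size M Q c * card Q ^ 2"
| "backend_cost M Q c Dense = length c * 2 ^ card Q"
| "backend_cost M Q c MPS = length c * card Q * bond_dim M Q c ^ 2"
| "backend_cost M Q c Rank =
     length c * (\<Sum>k\<le>weight_cap M Q c. T_count c choose k) * card Q ^ 2"

fun backend_error :: "leaf_oracle \<Rightarrow> nat set \<Rightarrow> circuit \<Rightarrow> backend \<Rightarrow> real" where
  "backend_error M Q c Frame = 0"
| "backend_error M Q c Dense = 0"
| "backend_error M Q c MPS = svd_discarded M Q c"
| "backend_error M Q c Rank =
     (\<Sum>k\<in>{weight_cap M Q c<..T_count c}.
        real (T_count c choose k) * tail_p M ^ k * tail_q M ^ (T_count c - k))"

text \<open>
  The guarantees of the backends on a leaf circuit \<open>c\<close> over the qubits \<open>Q\<close>. The factors \<open>\<kappa>\<close> are the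
  constants hidden in the \<open>O\<close> of the backend costs. The costs of an empty circuit are all 0, so time
  bounds in terms of them are meaningful only for circuits with at least one gate.
\<close>

definition meets_guarantees ::
    "(backend \<Rightarrow> nat) \<Rightarrow> leaf_oracle \<Rightarrow> nat set \<Rightarrow> circuit \<Rightarrow> bool"
  where "meets_guarantees \<kappa> M Q c \<longleftrightarrow>
    1 \<le> frame_size M Q c \<and> frame_size M Q c \<le> 2 ^ T_count c \<and> 1 \<le> bond_dim M Q c \<and>
    (\<forall>b. \<forall>y\<in>bitstrings Q.
       cmod (answer M b Q c y - amplitude Q c y) \<le> backend_error M Q c b \<and>
       run_time M b Q c y \<le> \<kappa> b * backend_cost M Q c b)"

definition select_backend :: "leaf_oracle \<Rightarrow> real \<Rightarrow> nat set \<Rightarrow> circuit \<Rightarrow> backend"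
  where "select_backend M \<epsilon> Q c =
    arg_min (backend_cost M Q c) (\<lambda>b. backend_error M Q c b \<le> \<epsilon>)"

definition selected_cost :: "leaf_oracle \<Rightarrow> real \<Rightarrow> nat set \<Rightarrow> circuit \<Rightarrow> nat"
  where "selected_cost M \<epsilon> Q c = backend_cost M Q c (select_backend M \<epsilon> Q c)"

text \<open>
  The parameters of the oracle may differ between the leaf circuits of one side, so the per-leaf
  cost of a side is that of its most expensive leaf.
\<close>

definition leaf_cost ::
    "leaf_oracle \<Rightarrow> real \<Rightarrow> nat set \<Rightarrow> (bool list \<Rightarrow> circuit) \<Rightarrow> nat \<Rightarrow> nat"
  where "leaf_cost M \<epsilon> S leaf d = Max ((\<lambda>\<alpha>. selected_cost M \<epsilon> S (leaf \<alpha>)) ` paths d)"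

text \<open>
  Programs return their result together with the number of steps taken. A step is one arithmetic
  operation, one visit to a gate, one gate written to a leaf circuit, one bit of a path, or one
  backend inspected by the selector; a leaf call also takes the time of the backend chosen.
  Splitting \<open>x\<close> takes no steps, as the leaf calls can read the bits of their side in place.
\<close>

type_synonym 'a timed = "'a \<times> nat"

definition leaf_amplitude ::
    "leaf_oracle \<Rightarrow> real \<Rightarrow> nat set \<Rightarrow> circuit \<Rightarrow> bits \<Rightarrow> complex timed"
  where "leaf_amplitude M \<epsilon> Q c y =
    (let b = select_backend M \<epsilon> Q c in (answer M b Q c y, 4 + run_time M b Q c y))"

fun build_path ::
    "nat set \<Rightarrow> nat set \<Rightarrow> (gate \<Rightarrow> splitting) \<Rightarrow> circuit \<Rightarrow> bool list
     \<Rightarrow> (complex \<times> circuit \<times> circuit) timed" where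
  "build_path A B dec [] \<alpha> = ((1, [], []), 1)"
| "build_path A B dec (g # C) \<alpha> =
     (if cross_cut A B g then
        let ((ph, a, b), t) = build_path A B dec C (tl \<alpha>)
        in ((coef (dec g) (hd \<alpha>) * ph,
             Op1 (opA (dec g) (hd \<alpha>)) (the_elem (qubits g \<inter> A)) # a,
             Op1 (opB (dec g) (hd \<alpha>)) (the_elem (qubits g \<inter> B)) # b), t + 4)
      else
        let ((ph, a, b), t) = build_path A B dec C \<alpha>
        in if qubits g \<subseteq> A then ((ph, g # a, b), t + 2) else ((ph, a, g # b), t + 2))"

fun sum_paths ::
    "leaf_oracle \<Rightarrow> real \<Rightarrow> nat set \<Rightarrow> nat set \<Rightarrow> (gate \<Rightarrow> splitting) \<Rightarrow> circuit \<Rightarrow> bits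
     \<Rightarrow> bool list list \<Rightarrow> complex \<Rightarrow> complex timed" where
  "sum_paths M \<epsilon> A B dec C x [] s = (s, 0)"
| "sum_paths M \<epsilon> A B dec C x (\<alpha> # \<alpha>s) s =
     (let ((ph, a, b), t) = build_path A B dec C \<alpha>;
          (amp_A, t_A) = leaf_amplitude M \<epsilon> A a (restrict x A);
          (amp_B, t_B) = leaf_amplitude M \<epsilon> B b (restrict x B);
          (result, t') = sum_paths M \<epsilon> A B dec C x \<alpha>s (s + ph * amp_A * amp_B)
      in (result, length \<alpha> + t + t_A + t_B + 3 + t'))"

definition single_level ::
    "leaf_oracle \<Rightarrow> real \<Rightarrow> nat set \<Rightarrow> nat set \<Rightarrow> (gate \<Rightarrow> splitting) \<Rightarrow> circuit \<Rightarrow> bits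
     \<Rightarrow> complex timed"
  where "single_level M \<epsilon> A B dec C x =
    (let d = cross_cut_count A B C;
         (result, t) = sum_paths M \<epsilon> A B dec C x (List.n_lists d [False, True]) 0
     in (result, length C + t))"

end

theory Submission
  imports Defs
begin

text \<open>
  A gate local to one side acts on one factor of a product state \<open>\<phi>\<^sub>A \<otimes> \<phi>\<^sub>B\<close>, and a cross-cut gate
  turns such a state into a combination of two product states, one for each bit; since the remaining
  circuit is linear, starting from the all-zero state yields the sum over paths.

  Every backend costs at least as many steps as the leaf circuit has gates, and every gate of \<open>C\<close>
  reaches at least one of the two leaf circuits, so the bookkeeping along a path, which is linear in
  the length of \<open>C\<close>, is absorbed by the cost of its two leaf calls.
\<close>

section \<open>Gates and states\<close>

lemma sum_bool: "(\<Sum>b\<in>UNIV. f b) = f False + f True" for f :: "bool \<Rightarrow> 'a::comm_monoid_add"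
  by (simp add: UNIV_bool add.commute)

lemma sum_bool_pair:
  "(\<Sum>p\<in>UNIV. f p) = f (False, False) + f (False, True) + f (True, False) + f (True, True)"
  for f :: "bool \<times> bool \<Rightarrow> 'a::comm_monoid_add"
proof -
  have "(\<Sum>p\<in>UNIV. f p) = (\<Sum>a\<in>UNIV. \<Sum>b\<in>UNIV. f (a, b))"
    by (simp add: sum.cartesian_product flip: UNIV_Times_UNIV)
  then show ?thesis
    by (simp add: sum_bool ac_simps)
qed

lemma bitstrings_upd: "y \<in> bitstrings Q \<Longrightarrow> q \<in> Q \<Longrightarrow> y(q := b) \<in> bitstrings Q"
  unfolding bitstrings_def by (auto simp: PiE_iff extensional_def)

lemma restrict_bitstrings: "restrict x A \<in> bitstrings A"
  unfolding bitstrings_def by auto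

lemma restrict_upd_in: "q \<in> A \<Longrightarrow> restrict (y(q := b)) A = (restrict y A)(q := b)"
  by auto

lemma restrict_upd_notin: "q \<notin> A \<Longrightarrow> restrict (y(q := b)) A = restrict y A"
  by (auto simp: restrict_def)

text \<open>Only the values on bit strings of \<open>Q\<close> enter, because a gate on qubits of
  \<open>Q\<close> reads its input at strings that differ from \<open>y\<close> on those qubits
  alone. Asking no more matters later: the all-zero state factorizes over the two sides only on such
  strings.\<close>

lemma apply_gate_linear:
  assumes "qubits g \<subseteq> Q" "\<forall>y\<in>bitstrings Q. \<psi> y = a * \<psi>1 y + b * \<psi>2 y" "y \<in> bitstrings Q"
  shows "apply_gate g \<psi> y = a * apply_gate g \<psi>1 y + b * apply_gate g \<psi>2 y"
  using assms
  by (cases g)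
     (simp_all add: apply1_def apply2_def sum_bool sum_bool_pair bitstrings_upd algebra_simps)

text \<open>Serves twice: to separate the two terms of a cross-cut gate and, with coefficients 1 and
  0, to exchange states that agree on bit strings.\<close>

lemma fold_apply_gate_linear:
  assumes "\<forall>g\<in>set C. qubits g \<subseteq> Q" "\<forall>y\<in>bitstrings Q. \<psi> y = a * \<psi>1 y + b * \<psi>2 y"
    "y \<in> bitstrings Q"
  shows "fold apply_gate C \<psi> y = a * fold apply_gate C \<psi>1 y + b * fold apply_gate C \<psi>2 y"
  using assms
proof (induction C arbitrary: \<psi> \<psi>1 \<psi>2)
  case (Cons g C)
  show ?case
    using Cons.IH[of "apply_gate g \<psi>" "apply_gate g \<psi>1" "apply_gate g \<psi>2"] Cons.prems
      apply_gate_linear[of g Q \<psi> a \<psi>1 b \<psi>2]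
    by simp
qed simp

section \<open>Product states across the bipartition\<close>

definition product_state ::
    "nat set \<Rightarrow> nat set \<Rightarrow> (bits \<Rightarrow> complex) \<Rightarrow> (bits \<Rightarrow> complex) \<Rightarrow> bits \<Rightarrow> complex"
  where "product_state A B \<phi> \<theta> y = \<phi> (restrict y A) * \<theta> (restrict y B)"

lemma product_state_commute: "product_state A B \<phi> \<theta> = product_state B A \<theta> \<phi>"
  by (auto simp: product_state_def)

text \<open>Updating a bit of \<open>A\<close> leaves \<open>restrict y B\<close> unchanged, so
  \<theta> contributes a common factor to the sum over bits.\<close>

lemma apply_gate_product_state:
  assumes "qubits g \<subseteq> A" "A \<inter> B = {}"
  shows "apply_gate g (product_state A B \<phi> \<theta>) = product_state A B (apply_gate g \<phi>) \<theta>"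
proof
  fix y
  have "q \<in> A \<and> q \<notin> B" if "q \<in> qubits g" for q
    using assms that by auto
  then show "apply_gate g (product_state A B \<phi> \<theta>) y = product_state A B (apply_gate g \<phi>) \<theta> y"
    by (cases g)
       (simp_all add: apply1_def apply2_def product_state_def sum_bool sum_bool_pair
          restrict_upd_in restrict_upd_notin algebra_simps)
qed

text \<open>For each \<alpha> the sum over the two updated bits factorizes, since each bit reaches
  only one of the two states.\<close>

lemma apply2_kron_product_state:
  fixes V W :: "bool \<Rightarrow> op1"
  assumes "U = (\<Sum>\<alpha>\<in>UNIV. kron (V \<alpha>) (W \<alpha>))" "q \<in> A" "r \<in> B" "A \<inter> B = {}"
  shows "apply2 U q r (product_state A B \<phi> \<theta>) y =
    (\<Sum>\<alpha>\<in>UNIV. product_state A B (apply1 (V \<alpha>) q \<phi>) (apply1 (W \<alpha>) r \<theta>) y)"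
proof -
  have "q \<notin> B" "r \<notin> A"
    using assms by auto
  with assms show ?thesis
    by (simp add: apply1_def apply2_def product_state_def sum_bool sum_bool_pair kron_def
          restrict_upd_in restrict_upd_notin algebra_simps)
qed

text \<open>For other \<open>y\<close> this can fail, as the two restrictions forget the values
  outside \<open>A \<union> B\<close>.\<close>

lemma ket_zero_product_state:
  assumes "y \<in> bitstrings (A \<union> B)"
  shows "ket (\<lambda>q\<in>A \<union> B. False) y =
    product_state A B (ket (\<lambda>q\<in>A. False)) (ket (\<lambda>q\<in>B. False)) y"
proof -
  have "y = (\<lambda>q\<in>A \<union> B. False) \<longleftrightarrow>
      restrict y A = (\<lambda>q\<in>A. False) \<and> restrict y B = (\<lambda>q\<in>B. False)"
    using assms unfolding bitstrings_def
    by (auto simp: fun_eq_iff restrict_def PiE_iff extensional_def split: if_splits)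
  then show ?thesis
    by (simp add: ket_def product_state_def)
qed

section \<open>The sum over paths\<close>

text \<open>The facts in each case decide the conditionals of \<open>leaf_circuit\<close>,
  \<open>path_phase\<close> and \<open>build_path\<close>, and the singleton intersections evaluate
  \<open>the_elem\<close>. A two-qubit gate with coinciding qubits counts as local.\<close>

lemma gate_sides:
  assumes "qubits g \<subseteq> A \<union> B" "A \<inter> B = {}"
  obtains "\<not> cross_cut A B g" "qubits g \<subseteq> A" "qubits g \<inter> B = {}" "\<not> qubits g \<subseteq> B"
  | "\<not> cross_cut A B g" "qubits g \<subseteq> B" "qubits g \<inter> A = {}" "\<not> qubits g \<subseteq> A"
  | qa qb where "cross_cut A B g" "qa \<in> A" "qb \<in> B" "qubits g \<inter> A = {qa}"
      "qubits g \<inter> B = {qb}" "\<not> qubits g \<subseteq> A" "\<not> qubits g \<subseteq> B"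
proof (cases g)
  case (Op2 U q r)
  have "q \<in> A \<or> q \<in> B" "r \<in> A \<or> r \<in> B" "\<not> (q \<in> A \<and> q \<in> B)" "\<not> (r \<in> A \<and> r \<in> B)"
    using assms Op2 by auto
  then consider "q \<in> A" "r \<in> A" "q \<notin> B" "r \<notin> B" | "q \<in> B" "r \<in> B" "q \<notin> A" "r \<notin> A"
    | "q \<in> A" "r \<in> B" "q \<notin> B" "r \<notin> A" | "q \<in> B" "r \<in> A" "q \<notin> A" "r \<notin> B"
    by blast
  then show ?thesis
    by cases (use Op2 that in auto)
qed (use assms that in auto)

section \<open>Paths as bit lists\<close>

lemma paths_0: "paths 0 = {[]}"
  by (auto simp: paths_def)

lemma paths_Suc: "paths (Suc d) = (\<lambda>(b, \<alpha>). b # \<alpha>) ` (UNIV \<times> paths d)"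
  by (auto simp: paths_def length_Suc_conv image_iff)

lemma sum_over_paths_Suc:
  "(\<Sum>\<alpha>\<in>paths (Suc d). f \<alpha>) = (\<Sum>b\<in>UNIV. \<Sum>\<alpha>\<in>paths d. f (b # \<alpha>))"
  for f :: "bool list \<Rightarrow> 'a::comm_monoid_add"
proof -
  have "inj_on (\<lambda>(b, \<alpha>). b # \<alpha>) (UNIV \<times> paths d)"
    by (auto simp: inj_on_def)
  then show ?thesis
    by (simp add: paths_Suc sum.reindex sum.cartesian_product case_prod_unfold)
qed

lemma set_n_lists_paths: "set (List.n_lists d [False, True]) = paths d"
proof -
  have "set xs \<subseteq> {False, True}" for xs :: "bool list"
    by (simp flip: UNIV_bool)
  then show ?thesis
    by (simp add: set_n_lists paths_def)
qed

lemma finite_paths: "finite (paths d)"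
  by (simp flip: set_n_lists_paths)

text \<open>In both tensor orders the coefficient sits in the \<open>A\<close> factor and comes out
  by linearity. The order with the first qubit in \<open>B\<close> reduces to the other by
  exchanging the sides.\<close>

lemma apply_cross_cut_product_state:
  assumes "splits A B g s" "A \<inter> B = {}" "qubits g \<inter> A = {qa}" "qubits g \<inter> B = {qb}"
  shows "apply_gate g (product_state A B \<phi> \<theta>) y =
    (\<Sum>b\<in>UNIV. coef s b
       * product_state A B (apply1 (opA s b) qa \<phi>) (apply1 (opB s b) qb \<theta>) y)"
proof -
  have scale: "product_state A B (apply1 (scale c V) q \<phi>) \<theta> y =
      c * product_state A B (apply1 V q \<phi>) \<theta> y" for c V q \<phi> \<theta>
    by (simp add: product_state_def apply1_def scale_def sum_distrib_left mult.assoc)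
  obtain U q r where g: "g = Op2 U q r"
    using assms(1) by (cases g) (auto simp: splits_def)
  let ?V = "\<lambda>b. scale (coef s b) (opA s b)"
  from assms(1) g consider
      "q \<in> A" "r \<in> B" "U = (\<Sum>b\<in>UNIV. kron (?V b) (opB s b))"
    | "q \<in> B" "r \<in> A" "U = (\<Sum>b\<in>UNIV. kron (opB s b) (?V b))"
    by (auto simp: splits_def)
  then show ?thesis
  proof cases
    case 1
    then have "qa = q" "qb = r"
      using assms(2-4) g by auto
    then show ?thesis
      using apply2_kron_product_state[OF 1(3,1,2) assms(2)] g by (simp add: scale)
  next
    case 2
    then have "qa = r" "qb = q"
      using assms(2-4) g by auto
    moreover have "B \<inter> A = {}"
      using assms(2) by auto
    ultimately show ?thesis
      using apply2_kron_product_state[OF 2(3,1,2)] g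
      by (simp add: product_state_commute[of B A] scale)
  qed
qed

text \<open>The two initial factors are arbitrary because the first gate changes them before the
  induction hypothesis applies.\<close>

lemma fold_apply_gate_product_state:
  assumes "\<forall>g\<in>set C. qubits g \<subseteq> A \<union> B" "A \<inter> B = {}"
    "\<forall>g\<in>set C. cross_cut A B g \<longrightarrow> splits A B g (dec g)"
    "y \<in> bitstrings (A \<union> B)"
  shows "fold apply_gate C (product_state A B \<phi> \<theta>) y =
    (\<Sum>\<alpha>\<in>paths (cross_cut_count A B C). path_phase A B dec C \<alpha>
       * fold apply_gate (leaf_A A dec C \<alpha>) \<phi> (restrict y A)
       * fold apply_gate (leaf_B B dec C \<alpha>) \<theta> (restrict y B))"
  using assms
proof (induction C arbitrary: \<phi> \<theta>)
  case Nil
  then show ?case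
    by (simp add: cross_cut_count_def paths_0 product_state_def del: restrict_apply)
next
  case (Cons g C)
  note IH = Cons.IH[OF _ Cons.prems(2) _ Cons.prems(4)]
  have g: "qubits g \<subseteq> A \<union> B"
    using Cons.prems(1) by simp
  show ?case
  proof (cases rule: gate_sides[OF g Cons.prems(2)])
    case 1
    then show ?thesis
      using IH Cons.prems
      by (simp add: apply_gate_product_state cross_cut_count_def)
  next
    case 2
    have "apply_gate g (product_state A B \<phi> \<theta>) = product_state A B \<phi> (apply_gate g \<theta>)"
      using apply_gate_product_state[of g B A \<theta> \<phi>] 2 Cons.prems(2)
      by (simp add: product_state_commute[of A B] Int_commute)
    then show ?thesis
      using 2 IH Cons.prems by (simp add: cross_cut_count_def)
  next
    case (3 qa qb)
    let ?\<psi> = "\<lambda>b. product_state A B (apply1 (opA (dec g) b) qa \<phi>) (apply1 (opB (dec g) b) qb \<theta>)"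
    have count: "cross_cut_count A B (g # C) = Suc (cross_cut_count A B C)"
      using 3 by (simp add: cross_cut_count_def)
    \<comment> \<open>By linearity of the remaining circuit the product state of each bit evolves
      alone and falls under the induction hypothesis.\<close>
    have "fold apply_gate (g # C) (product_state A B \<phi> \<theta>) y =
        coef (dec g) False * fold apply_gate C (?\<psi> False) y
        + coef (dec g) True * fold apply_gate C (?\<psi> True) y"
      using fold_apply_gate_linear[of C "A \<union> B"
          "apply_gate g (product_state A B \<phi> \<theta>)" "coef (dec g) False" "?\<psi> False"
          "coef (dec g) True" "?\<psi> True" y]
        apply_cross_cut_product_state[of A B g "dec g" qa qb] Cons.prems 3
      by (simp add: sum_bool)
    also have "\<dots> = (\<Sum>b\<in>UNIV. coef (dec g) b * fold apply_gate C (?\<psi> b) y)"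
      by (simp add: sum_bool)
    finally show ?thesis
      using 3 IH Cons.prems(1,3)
      by (simp add: count sum_over_paths_Suc sum_distrib_left mult.assoc Int_commute)
  qed
qed

lemma amplitude_over_paths:
  assumes "\<forall>g\<in>set C. qubits g \<subseteq> A \<union> B" "A \<inter> B = {}"
    "\<forall>g\<in>set C. cross_cut A B g \<longrightarrow> splits A B g (dec g)"
    "x \<in> bitstrings (A \<union> B)"
  shows "amplitude (A \<union> B) C x =
    (\<Sum>\<alpha>\<in>paths (cross_cut_count A B C). path_phase A B dec C \<alpha>
       * amplitude A (leaf_A A dec C \<alpha>) (restrict x A)
       * amplitude B (leaf_B B dec C \<alpha>) (restrict x B))"
proof -
  have "amplitude (A \<union> B) C x = fold apply_gate C
      (product_state A B (ket (\<lambda>q\<in>A. False)) (ket (\<lambda>q\<in>B. False))) x"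
    \<comment> \<open>With coefficients 1 and 0, linearity says that states agreeing on the bit
      strings of \<open>A \<union> B\<close> still agree after \<open>C\<close>.\<close>
    using fold_apply_gate_linear[OF assms(1) _ assms(4), where b = 0 and a = 1]
    by (simp add: amplitude_def ket_zero_product_state)
  then show ?thesis
    by (simp add: fold_apply_gate_product_state[OF assms] amplitude_def)
qed

section \<open>Result and running time of the algorithm\<close>

text \<open>A gate that is neither cross-cut nor inside \<open>A\<close> must lie in
  \<open>B\<close>, so the last branch of \<open>build_path\<close> agrees with
  \<open>leaf_B\<close>. A gate takes at most 4 steps, the empty list 1.\<close>

lemma build_path_correct:
  assumes "\<forall>g\<in>set C. qubits g \<subseteq> A \<union> B" "A \<inter> B = {}"
  shows "fst (build_path A B dec C \<alpha>) =
      (path_phase A B dec C \<alpha>, leaf_A A dec C \<alpha>, leaf_B B dec C \<alpha>)"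
    and "snd (build_path A B dec C \<alpha>) \<le> 1 + 4 * length C"
proof -
  have "fst (build_path A B dec C \<alpha>) =
      (path_phase A B dec C \<alpha>, leaf_A A dec C \<alpha>, leaf_B B dec C \<alpha>) \<and>
    snd (build_path A B dec C \<alpha>) \<le> 1 + 4 * length C"
    using assms
  proof (induction C arbitrary: \<alpha>)
    case (Cons g C)
    have g: "qubits g \<subseteq> A \<union> B"
      using Cons.prems(1) by simp
    show ?case
      by (cases rule: gate_sides[OF g Cons.prems(2)];
          use Cons.IH[of \<alpha>] Cons.IH[of "tl \<alpha>"] Cons.prems in
            \<open>auto simp: split_beta Let_def prod_eq_iff\<close>)
  qed simp
  then show "fst (build_path A B dec C \<alpha>) =
      (path_phase A B dec C \<alpha>, leaf_A A dec C \<alpha>, leaf_B B dec C \<alpha>)"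
    and "snd (build_path A B dec C \<alpha>) \<le> 1 + 4 * length C"
    by auto
qed

lemma sum_paths_eq:
  assumes "\<forall>g\<in>set C. qubits g \<subseteq> A \<union> B" "A \<inter> B = {}"
  shows "fst (sum_paths M \<epsilon> A B dec C x \<alpha>s s) = s +
    (\<Sum>\<alpha>\<leftarrow>\<alpha>s. path_phase A B dec C \<alpha>
       * fst (leaf_amplitude M \<epsilon> A (leaf_A A dec C \<alpha>) (restrict x A))
       * fst (leaf_amplitude M \<epsilon> B (leaf_B B dec C \<alpha>) (restrict x B)))"
  by (induction \<alpha>s arbitrary: s)
     (simp_all add: split_beta Let_def build_path_correct(1)[OF assms])

text \<open>The added constant 4 is the 1 step of \<open>build_path\<close> on the empty list plus
  the 3 operations that update the total.\<close>

lemma sum_paths_time: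
  assumes "\<forall>g\<in>set C. qubits g \<subseteq> A \<union> B" "A \<inter> B = {}"
    and "\<And>\<alpha>. \<alpha> \<in> set \<alpha>s \<Longrightarrow> length \<alpha> + (4 * length C + 4)
      + snd (leaf_amplitude M \<epsilon> A (leaf_A A dec C \<alpha>) (restrict x A))
      + snd (leaf_amplitude M \<epsilon> B (leaf_B B dec C \<alpha>) (restrict x B)) \<le> t"
  shows "snd (sum_paths M \<epsilon> A B dec C x \<alpha>s s) \<le> length \<alpha>s * t"
  using assms(3)
proof (induction \<alpha>s arbitrary: s)
  case (Cons \<alpha> \<alpha>s)
  have "length \<alpha> + snd (build_path A B dec C \<alpha>)
      + snd (leaf_amplitude M \<epsilon> A (leaf_A A dec C \<alpha>) (restrict x A))
      + snd (leaf_amplitude M \<epsilon> B (leaf_B B dec C \<alpha>) (restrict x B)) + 3 \<le> t"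
    using Cons.prems[of \<alpha>] build_path_correct(2)[OF assms(1,2), of dec \<alpha>] by fastforce
  moreover have "snd (sum_paths M \<epsilon> A B dec C x \<alpha>s s') \<le> length \<alpha>s * t" for s'
    using Cons by simp
  ultimately show ?case
    by (simp add: split_beta Let_def build_path_correct(1)[OF assms(1,2)] add_mono)
qed simp

text \<open>The frame backend is exact, so the set of admissible backends is never empty.\<close>

lemma select_backend_error:
  assumes "0 \<le> \<epsilon>"
  shows "backend_error M Q c (select_backend M \<epsilon> Q c) \<le> \<epsilon>"
  unfolding select_backend_def
  by (rule arg_min_natI[where k = Frame]) (simp add: assms)

lemma leaf_amplitude_error:
  assumes "meets_guarantees \<kappa> M Q c" "0 \<le> \<epsilon>" "y \<in> bitstrings Q"
  shows "cmod (fst (leaf_amplitude M \<epsilon> Q c y) - amplitude Q c y) \<le> \<epsilon>"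
  using assms(1,3) select_backend_error[OF assms(2), of M Q c]
  unfolding meets_guarantees_def leaf_amplitude_def Let_def by (auto intro: order_trans)

text \<open>The 4 counts the backends inspected by the selector; bounding all of \<kappa> by
  \<open>k\<close> makes the estimate independent of the choice made.\<close>

lemma leaf_amplitude_time:
  assumes "meets_guarantees \<kappa> M Q c" "y \<in> bitstrings Q" "\<And>b. \<kappa> b \<le> k"
  shows "snd (leaf_amplitude M \<epsilon> Q c y) \<le> 4 + k * selected_cost M \<epsilon> Q c"
proof -
  let ?b = "select_backend M \<epsilon> Q c"
  have "run_time M ?b Q c y \<le> \<kappa> ?b * backend_cost M Q c ?b"
    using assms(1,2) unfolding meets_guarantees_def by blast
  also have "\<dots> \<le> k * selected_cost M \<epsilon> Q c"
    using assms(3) by (simp add: selected_cost_def)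
  finally show ?thesis
    by (simp add: leaf_amplitude_def Let_def)
qed

text \<open>Each cost is the length times factors that are at least 1: a gate meeting
  \<open>Q\<close> makes \<open>card Q\<close> positive, and the guarantees bound the frame size and
  the bond dimension from below.\<close>

lemma length_le_backend_cost:
  assumes "meets_guarantees \<kappa> M Q c" "finite Q" "\<forall>g\<in>set c. qubits g \<inter> Q \<noteq> {}"
  shows "length c \<le> backend_cost M Q c b"
proof (cases "c = []")
  case False
  then have "Q \<noteq> {}"
    using assms(3) by (cases c) auto
  then have Q: "1 \<le> card Q"
    using assms(2) by (simp add: Suc_le_eq card_gt_0_iff)
  have M: "1 \<le> frame_size M Q c" "1 \<le> bond_dim M Q c"
    using assms(1) by (auto simp: meets_guarantees_def)
  \<comment> \<open>The term for \<open>k = 0\<close> is 1, whatever the weight cap.\<close>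
  have rank: "1 \<le> (\<Sum>k\<le>weight_cap M Q c. T_count c choose k)"
    using member_le_sum[of 0 "{..weight_cap M Q c}" "\<lambda>k. T_count c choose k"] by simp
  have *: "length c \<le> length c * i * j" if "1 \<le> i" "1 \<le> j" for i j :: nat
    using mult_le_mono[OF that] by (simp add: mult.assoc)
  show ?thesis
    using *[OF M(1), of "card Q ^ 2"] *[of 1 "2 ^ card Q"] *[OF Q, of "bond_dim M Q c ^ 2"]
      *[OF rank, of "card Q ^ 2"] Q M
    by (cases b) simp_all
qed simp


section \<open>Gates of the leaf circuits\<close>

lemma qubits_nonempty: "qubits g \<noteq> {}"
  by (cases g) auto

text \<open>Supplies the hypothesis of \<open>length_le_backend_cost\<close>: a gate kept whole has
  a qubit and lies in \<open>S\<close>, and the factor of a cross-cut gate acts on its one qubit in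
  \<open>S\<close>.\<close>

lemma leaf_circuit_meets_side:
  assumes "\<forall>g\<in>set C. qubits g \<subseteq> A \<union> B" "A \<inter> B = {}" "S = A \<or> S = B"
  shows "\<forall>g\<in>set (leaf_circuit S u C \<alpha>). qubits g \<inter> S \<noteq> {}"
  using assms(1)
proof (induction C arbitrary: \<alpha>)
  case (Cons g C)
  have g: "qubits g \<subseteq> A \<union> B"
    using Cons.prems(1) by simp
  show ?case
    by (cases rule: gate_sides[OF g assms(2)];
        use Cons.IH[of \<alpha>] Cons.IH[of "tl \<alpha>"] Cons.prems assms(3) qubits_nonempty[of g] in
          \<open>auto simp: Int_absorb2\<close>)
qed simp

text \<open>A local gate lands in one leaf circuit, and a cross-cut gate leaves a factor in
  both.\<close>

lemma length_le_leaf_circuits: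
  assumes "\<forall>g\<in>set C. qubits g \<subseteq> A \<union> B" "A \<inter> B = {}"
  shows "length C \<le> length (leaf_circuit A u C \<alpha>) + length (leaf_circuit B v C \<alpha>)"
  using assms(1)
proof (induction C arbitrary: \<alpha>)
  case (Cons g C)
  have g: "qubits g \<subseteq> A \<union> B"
    using Cons.prems(1) by simp
  show ?case
    by (cases rule: gate_sides[OF g assms(2)];
        use Cons.IH[of \<alpha>] Cons.IH[of "tl \<alpha>"] Cons.prems in auto)
qed simp

text \<open>\<open>K\<close> is chosen before the circuit, the oracle and the tolerance, so it
  depends on \<kappa> alone; this is the uniformity expressed by the O.\<close>

theorem proposition2:
  fixes \<kappa> :: "backend \<Rightarrow> nat"
  shows "\<exists>K::nat. \<forall>(n::nat) (C::circuit) (A::nat set) (B::nat set) (d::nat)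
           (dec::gate \<Rightarrow> splitting) (M::leaf_oracle) (\<epsilon>::real) (x::bits).
    clifford_T_circuit n C \<longrightarrow>
    A \<union> B = {..<n} \<longrightarrow> A \<inter> B = {} \<longrightarrow>
    d = cross_cut_count A B C \<longrightarrow>
    (\<forall>g\<in>set C. cross_cut A B g \<longrightarrow> splits A B g (dec g)) \<longrightarrow>
    0 \<le> \<epsilon> \<longrightarrow>
    (\<forall>\<alpha>\<in>paths d. meets_guarantees \<kappa> M A (leaf_A A dec C \<alpha>) \<and>
                  meets_guarantees \<kappa> M B (leaf_B B dec C \<alpha>)) \<longrightarrow>
    x \<in> bitstrings {..<n} \<longrightarrow>
      amplitude {..<n} C x =
        (\<Sum>\<alpha>\<in>paths d. path_phase A B dec C \<alpha>
           * amplitude A (leaf_A A dec C \<alpha>) (restrict x A)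
           * amplitude B (leaf_B B dec C \<alpha>) (restrict x B)) \<and>
      fst (single_level M \<epsilon> A B dec C x) =
        (\<Sum>\<alpha>\<in>paths d. path_phase A B dec C \<alpha>
           * fst (leaf_amplitude M \<epsilon> A (leaf_A A dec C \<alpha>) (restrict x A))
           * fst (leaf_amplitude M \<epsilon> B (leaf_B B dec C \<alpha>) (restrict x B))) \<and>
      (\<forall>\<alpha>\<in>paths d.
         cmod (fst (leaf_amplitude M \<epsilon> A (leaf_A A dec C \<alpha>) (restrict x A))
               - amplitude A (leaf_A A dec C \<alpha>) (restrict x A)) \<le> \<epsilon> \<and>
         cmod (fst (leaf_amplitude M \<epsilon> B (leaf_B B dec C \<alpha>) (restrict x B))
               - amplitude B (leaf_B B dec C \<alpha>) (restrict x B)) \<le> \<epsilon>) \<and>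
      (C \<noteq> [] \<longrightarrow>
         snd (single_level M \<epsilon> A B dec C x)
           \<le> K * (2 ^ d * (leaf_cost M \<epsilon> A (leaf_A A dec C) d + leaf_cost M \<epsilon> B (leaf_B B dec C) d)))"
proof -
  define k where "k = \<kappa> Frame + \<kappa> Dense + \<kappa> MPS + \<kappa> Rank"
  have k: "\<kappa> b \<le> k" for b
    by (cases b) (simp_all add: k_def)
  show ?thesis
  \<comment> \<open>Here \<open>17 + k\<close> pays for each path, and one more unit for counting
    the cross-cut gates of \<open>C\<close>.\<close>
  proof (intro exI[of _ "18 + k"] allI impI conjI ballI)
    fix n C A B d dec M \<epsilon> x
    assume C: "clifford_T_circuit n C"
      and AB: "A \<union> B = {..<n}" "A \<inter> B = {}"
      and d: "d = cross_cut_count A B C"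
      and dec: "\<forall>g\<in>set C. cross_cut A B g \<longrightarrow> splits A B g (dec g)"
      and \<epsilon>: "(0::real) \<le> \<epsilon>"
      and M: "\<forall>\<alpha>\<in>paths d. meets_guarantees \<kappa> M A (leaf_A A dec C \<alpha>) \<and>
                meets_guarantees \<kappa> M B (leaf_B B dec C \<alpha>)"
      and x: "x \<in> bitstrings {..<n}"
    have Q: "\<forall>g\<in>set C. qubits g \<subseteq> A \<union> B"
      using C AB(1) by (simp add: clifford_T_circuit_def)
    show "amplitude {..<n} C x =
        (\<Sum>\<alpha>\<in>paths d. path_phase A B dec C \<alpha>
           * amplitude A (leaf_A A dec C \<alpha>) (restrict x A)
           * amplitude B (leaf_B B dec C \<alpha>) (restrict x B))"
      using amplitude_over_paths[OF Q AB(2) dec] x AB(1) d by simp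
    show "fst (single_level M \<epsilon> A B dec C x) =
        (\<Sum>\<alpha>\<in>paths d. path_phase A B dec C \<alpha>
           * fst (leaf_amplitude M \<epsilon> A (leaf_A A dec C \<alpha>) (restrict x A))
           * fst (leaf_amplitude M \<epsilon> B (leaf_B B dec C \<alpha>) (restrict x B)))"
      \<comment> \<open>\<open>List.n_lists\<close> enumerates each path exactly once, so the sum
        over the list is a sum over \<open>paths d\<close>.\<close>
      by (simp add: single_level_def split_beta Let_def sum_paths_eq[OF Q AB(2)]
            sum_list_distinct_conv_sum_set distinct_n_lists set_n_lists_paths flip: d)
    {
      fix \<alpha>
      assume \<alpha>: "\<alpha> \<in> paths d"
      show "cmod (fst (leaf_amplitude M \<epsilon> A (leaf_A A dec C \<alpha>) (restrict x A))
               - amplitude A (leaf_A A dec C \<alpha>) (restrict x A)) \<le> \<epsilon>"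
        using leaf_amplitude_error M \<alpha> \<epsilon> restrict_bitstrings by blast
      show "cmod (fst (leaf_amplitude M \<epsilon> B (leaf_B B dec C \<alpha>) (restrict x B))
               - amplitude B (leaf_B B dec C \<alpha>) (restrict x B)) \<le> \<epsilon>"
        using leaf_amplitude_error M \<alpha> \<epsilon> restrict_bitstrings by blast
    }
    assume "C \<noteq> []"
    then have C1: "1 \<le> length C"
      by (simp add: Suc_le_eq)
    let ?cost = "leaf_cost M \<epsilon> A (leaf_A A dec C) d + leaf_cost M \<epsilon> B (leaf_B B dec C) d"
    have fin: "finite A" "finite B"
      using AB(1) by (metis finite_Un finite_lessThan)+
    have le_cost: "selected_cost M \<epsilon> S (leaf \<alpha>) \<le> leaf_cost M \<epsilon> S leaf d"
      if "\<alpha> \<in> paths d" for S leaf \<alpha>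
      using that finite_paths by (simp add: leaf_cost_def)
    \<comment> \<open>One of the two leaf circuits may be empty, so it is the sum of both costs that
      is compared with the length of \<open>C\<close>.\<close>
    have length_C: "length C \<le> ?cost" if \<alpha>: "\<alpha> \<in> paths d" for \<alpha>
    proof -
      have "length (leaf_A A dec C \<alpha>) \<le> selected_cost M \<epsilon> A (leaf_A A dec C \<alpha>)"
        "length (leaf_B B dec C \<alpha>) \<le> selected_cost M \<epsilon> B (leaf_B B dec C \<alpha>)"
        unfolding selected_cost_def
        using length_le_backend_cost leaf_circuit_meets_side[OF Q AB(2)] M \<alpha> fin by blast+
      then show ?thesis
        using length_le_leaf_circuits[OF Q AB(2)] le_cost[OF \<alpha>]
        by (meson add_mono order_trans)
    qed
    have "d \<le> length C"
      by (simp add: d cross_cut_count_def)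
    \<comment> \<open>17 = 1 + 4 + 4 + 8: the bits of the path, the two terms of
      \<open>4 * length C + 4\<close>, and the two selector runs of 4 steps each. All are absorbed
      through \<open>1 \<le> length C\<close> and \<open>length C \<le> ?cost\<close>.\<close>
    have path_time: "length \<alpha> + (4 * length C + 4)
        + snd (leaf_amplitude M \<epsilon> A (leaf_A A dec C \<alpha>) (restrict x A))
        + snd (leaf_amplitude M \<epsilon> B (leaf_B B dec C \<alpha>) (restrict x B)) \<le> (17 + k) * ?cost"
      if \<alpha>: "\<alpha> \<in> paths d" for \<alpha>
    proof -
      have leaf: "snd (leaf_amplitude M \<epsilon> S (leaf \<alpha>) (restrict x S))
          \<le> 4 + k * leaf_cost M \<epsilon> S leaf d"
        if "meets_guarantees \<kappa> M S (leaf \<alpha>)" for S leaf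
        using leaf_amplitude_time[OF that restrict_bitstrings k]
          mult_le_mono2[OF le_cost[OF \<alpha>, of S leaf], of k]
        by (meson add_left_mono order_trans)
      have "length \<alpha> \<le> length C"
        using \<alpha> \<open>d \<le> length C\<close> by (simp add: paths_def)
      then show ?thesis
        using leaf[of A "leaf_A A dec C"] leaf[of B "leaf_B B dec C"] M \<alpha> length_C[OF \<alpha>] C1
        by (simp add: algebra_simps)
    qed
    have "snd (single_level M \<epsilon> A B dec C x) \<le> length C + 2 ^ d * ((17 + k) * ?cost)"
    proof -
      have "snd (sum_paths M \<epsilon> A B dec C x (List.n_lists d [False, True]) 0)
          \<le> length (List.n_lists d [False, True]) * ((17 + k) * ?cost)"
        using path_time by (intro sum_paths_time[OF Q AB(2)]) (simp only: set_n_lists_paths)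
      then show ?thesis
        by (simp add: single_level_def split_beta Let_def length_n_lists numeral_2_eq_2 flip: d)
    qed
    also have "length C \<le> 2 ^ d * ?cost"
    proof -
      \<comment> \<open>Some path must exist for \<open>length_C\<close> to apply; its conclusion no
        longer mentions the path.\<close>
      have "replicate d False \<in> paths d"
        by (simp add: paths_def)
      then have "length C \<le> ?cost"
        by (rule length_C)
      also have "\<dots> \<le> 2 ^ d * ?cost"
        by simp
      finally show ?thesis .
    qed
    finally show "snd (single_level M \<epsilon> A B dec C x) \<le> (18 + k) * (2 ^ d * ?cost)"
      by (simp add: algebra_simps)
  qed
qed

end
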